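(* Let $R$ be a ring and let $M$ be a left $R$-module that is projective in $\sigma[M]$. If $M$ is a pm-module, then $$\mathrm{pt}(SPm(M))=\mathrm{Prt}(M)=\mathrm{Max}(M).$$
   Context: Rings are associative with identity, not necessarily commutative; modules are unital left modules. $\sigma[M]$ is the full subcategory of $R$-modules consisting of all modules that embed in an $M$-generated module (a quotient of a direct sum of copies of $M$). $M$ is projective in $\sigma[M]$ if for every epimorphism $X\to Y$ in $\sigma[M]$ the induced map $\mathrm{Hom}_R(M,X)\to\mathrm{Hom}_R(M,Y)$ is surjective. A submodule $N\leq M$ is fully invariant if $f(N)\subseteq N$ for all $f\in\mathrm{End}_R(M)$. For $N\leq M$ and a module $K$, $N_MK=\sum\{f(N)\mid f\in\mathrm{Hom}_R(M,K)\}$ and $\mathrm{Ann}_M(K)=\bigcap\{\ker f\mid f\in\mathrm{Hom}_R(M,K)\}$. A proper fully invariant submodule $P$ of $M$ is prime in $M$ if $L_MK\leq P$ with $L,K$ fully invariant submodules of $M$ implies $L\leq P$ or $K\leq P$. $M$ is a pm-module if every prime submodule of $M$ is contained in a unique maximal submodule of $M$. $\mathrm{Max}(M)$ is the set of maximal submodules of $M$. A proper submodule $P<M$ is primitive if $P=\mathrm{Ann}_M(S)$ for some simple module $S\in\sigma[M]$; $\mathrm{Prt}(M)$ is the set of primitive submodules; a submodule is semiprimitive if it is an intersection of primitive submodules. $SPm(M)$ is the frame, ordered by inclusion (with meet given by intersection and top element $M$), consisting of $M$ and all semiprimitive submodules of $M$. A point of a frame $A$ is an element $p\neq 1$ such that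 $a\wedge b\leq p$ implies $a\leq p$ or $b\leq p$; $\mathrm{pt}(A)$ is the set of points of $A$. *)

theory Defs
  imports "HOL-Algebra.Module" "HOL-Library.Countable_Set"
begin

section \<open>Left modules over a not necessarily commutative ring\<close>

text \<open>The library's \<^locale>\<open>module\<close> with \<^locale>\<open>cring\<close> relaxed to \<^locale>\<open>ring\<close>. The library's
  \<^locale>\<open>submodule\<close> does not mention commutativity and is used as it stands; a submodule \<open>K\<close> of
  \<open>M\<close> is regarded as a module in the form \<open>M\<lparr>carrier := K\<rparr>\<close>.\<close>

locale left_module = R?: ring R + M?: abelian_group M
  for R :: "('r, 'c) ring_scheme" and M :: "('r, 'm) module" (structure) +
  assumes smult_closed [simp, intro]:
      "\<lbrakk>a \<in> carrier R; x \<in> carrier M\<rbrakk> \<Longrightarrow> a \<odot>\<^bsub>M\<^esub> x \<in> carrier M"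
    and smult_l_distr:
      "\<lbrakk>a \<in> carrier R; b \<in> carrier R; x \<in> carrier M\<rbrakk> \<Longrightarrow>
        (a \<oplus>\<^bsub>R\<^esub> b) \<odot>\<^bsub>M\<^esub> x = a \<odot>\<^bsub>M\<^esub> x \<oplus>\<^bsub>M\<^esub> b \<odot>\<^bsub>M\<^esub> x"
    and smult_r_distr:
      "\<lbrakk>a \<in> carrier R; x \<in> carrier M; y \<in> carrier M\<rbrakk> \<Longrightarrow>
        a \<odot>\<^bsub>M\<^esub> (x \<oplus>\<^bsub>M\<^esub> y) = a \<odot>\<^bsub>M\<^esub> x \<oplus>\<^bsub>M\<^esub> a \<odot>\<^bsub>M\<^esub> y"
    and smult_assoc1:
      "\<lbrakk>a \<in> carrier R; b \<in> carrier R; x \<in> carrier M\<rbrakk> \<Longrightarrow>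
        (a \<otimes>\<^bsub>R\<^esub> b) \<odot>\<^bsub>M\<^esub> x = a \<odot>\<^bsub>M\<^esub> (b \<odot>\<^bsub>M\<^esub> x)"
    and smult_one [simp]:
      "x \<in> carrier M \<Longrightarrow> \<one>\<^bsub>R\<^esub> \<odot>\<^bsub>M\<^esub> x = x"

definition Hom :: "('r, 'c) ring_scheme \<Rightarrow> ('r, 'm) module \<Rightarrow> ('r, 'n) module \<Rightarrow> ('m \<Rightarrow> 'n) set" where
  "Hom R M N = {f \<in> carrier M \<rightarrow> carrier N.
      (\<forall>x\<in>carrier M. \<forall>y\<in>carrier M. f (x \<oplus>\<^bsub>M\<^esub> y) = f x \<oplus>\<^bsub>N\<^esub> f y) \<and>
      (\<forall>r\<in>carrier R. \<forall>x\<in>carrier M. f (r \<odot>\<^bsub>M\<^esub> x) = r \<odot>\<^bsub>N\<^esub> f x)}"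

text \<open>The epimorphisms of \<open>\<sigma>[M]\<close> are the surjective homomorphisms, because \<open>\<sigma>[M]\<close> is
  closed under factor modules.\<close>

definition surjective_on :: "('r, 'm) module \<Rightarrow> ('r, 'n) module \<Rightarrow> ('m \<Rightarrow> 'n) \<Rightarrow> bool" where
  "surjective_on M N f \<longleftrightarrow> f ` carrier M = carrier N"

definition simple_module :: "('r, 'c) ring_scheme \<Rightarrow> ('r, 'm) module \<Rightarrow> bool" where
  "simple_module R S \<longleftrightarrow> left_module R S \<and> carrier S \<noteq> {\<zero>\<^bsub>S\<^esub>} \<and>
     (\<forall>N. submodule N R S \<longrightarrow> N = {\<zero>\<^bsub>S\<^esub>} \<or> N = carrier S)"


section \<open>The category \<open>\<sigma>[M]\<close> and projectivity\<close>

text \<open>The direct sum of copies of \<open>M\<close> indexed by \<open>I\<close>; families are extended by zero outside \<open>I\<close>.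
  The ring-multiplication fields of a module record carry no meaning.\<close>

definition direct_sum :: "('r, 'm) module \<Rightarrow> 'i set \<Rightarrow> ('r, 'i \<Rightarrow> 'm) module" where
  "direct_sum M I =
     \<lparr>carrier = {f. (\<forall>i\<in>I. f i \<in> carrier M) \<and> (\<forall>i. i \<notin> I \<longrightarrow> f i = \<zero>\<^bsub>M\<^esub>) \<and> finite {i. f i \<noteq> \<zero>\<^bsub>M\<^esub>}},
      monoid.mult = undefined, one = undefined,
      zero = (\<lambda>i. \<zero>\<^bsub>M\<^esub>), add = (\<lambda>f g i. f i \<oplus>\<^bsub>M\<^esub> g i),
      smult = (\<lambda>r f i. if i \<in> I then r \<odot>\<^bsub>M\<^esub> f i else \<zero>\<^bsub>M\<^esub>)\<rparr>"

definition generated_by ::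
  "('r, 'c) ring_scheme \<Rightarrow> ('r, 'm) module \<Rightarrow> 'i set \<Rightarrow> ('r, 'g) module \<Rightarrow> bool" where
  "generated_by R M I G \<longleftrightarrow> left_module R G \<and> (\<exists>p\<in>Hom R (direct_sum M I) G. surjective_on (direct_sum M I) G p)"

text \<open>HOL cannot quantify over types inside a formula, so the index set \<open>I\<close> and the \<open>M\<close>-generated
  module \<open>G\<close> are sought on types determined by that of \<open>X\<close>. These are large enough: by
  \<open>in_sigmaI\<close> below, \<open>I\<close> and \<open>G\<close> on arbitrary types give the same notion.\<close>

definition in_sigma :: "('r, 'c) ring_scheme \<Rightarrow> ('r, 'm) module \<Rightarrow> ('r, 'x) module \<Rightarrow> bool" where
  "in_sigma R M X \<longleftrightarrow> left_module R X \<and>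
     (\<exists>(I :: ('x \<times> nat) set) (G :: ('r, ('x \<times> nat \<Rightarrow> 'm) set) module).
        generated_by R M I G \<and> (\<exists>j\<in>Hom R X G. inj_on j (carrier X)))"

text \<open>For the same reason, modules that are quantified over in hypotheses live on the type
  \<open>('r \<times> 'm) list\<close>. By \<open>projective_in_sigmaD\<close> and \<open>primitive_submodulesI\<close> below,
  this is no restriction: the defining properties carry over to modules on arbitrary types.\<close>

type_synonym ('r, 'm) test_module = "('r, ('r \<times> 'm) list) module"

definition projective_in_sigma :: "('r, 'c) ring_scheme \<Rightarrow> ('r, 'm) module \<Rightarrow> bool" where
  "projective_in_sigma R M \<longleftrightarrow>
     (\<forall>(X :: ('r, 'm) test_module) (Y :: ('r, 'm) test_module).
        in_sigma R M X \<longrightarrow> in_sigma R M Y \<longrightarrow>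
        (\<forall>g\<in>Hom R X Y. surjective_on X Y g \<longrightarrow>
           (\<forall>f\<in>Hom R M Y. \<exists>h\<in>Hom R M X. \<forall>x\<in>carrier M. g (h x) = f x)))"


section \<open>Submodules of \<open>M\<close>\<close>

definition fully_invariant :: "('r, 'c) ring_scheme \<Rightarrow> ('r, 'm) module \<Rightarrow> 'm set \<Rightarrow> bool" where
  "fully_invariant R M N \<longleftrightarrow> submodule N R M \<and> (\<forall>f\<in>Hom R M M. f ` N \<subseteq> N)"

text \<open>The product \<open>N\<^sub>M K\<close>; the sum of the submodules \<open>f(N)\<close> is the least submodule of \<open>K\<close>
  containing them all.\<close>

definition mprod ::
  "('r, 'c) ring_scheme \<Rightarrow> ('r, 'm) module \<Rightarrow> 'm set \<Rightarrow> ('r, 'k) module \<Rightarrow> 'k set" where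
  "mprod R M N K = \<Inter>{L. submodule L R K \<and> (\<forall>f\<in>Hom R M K. f ` N \<subseteq> L)}"

definition Ann :: "('r, 'c) ring_scheme \<Rightarrow> ('r, 'm) module \<Rightarrow> ('r, 'k) module \<Rightarrow> 'm set" where
  "Ann R M K = (\<Inter>f\<in>Hom R M K. {x \<in> carrier M. f x = \<zero>\<^bsub>K\<^esub>})"

definition prime_in :: "('r, 'c) ring_scheme \<Rightarrow> ('r, 'm) module \<Rightarrow> 'm set \<Rightarrow> bool" where
  "prime_in R M P \<longleftrightarrow> fully_invariant R M P \<and> P \<noteq> carrier M \<and>
     (\<forall>L K. fully_invariant R M L \<longrightarrow> fully_invariant R M K \<longrightarrow>
        mprod R M L (M\<lparr>carrier := K\<rparr>) \<subseteq> P \<longrightarrow> L \<subseteq> P \<or> K \<subseteq> P)"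

definition Max_submodules :: "('r, 'c) ring_scheme \<Rightarrow> ('r, 'm) module \<Rightarrow> 'm set set" where
  "Max_submodules R M = {N. submodule N R M \<and> N \<noteq> carrier M \<and>
     (\<forall>L. submodule L R M \<longrightarrow> N \<subseteq> L \<longrightarrow> L = N \<or> L = carrier M)}"

definition pm_module :: "('r, 'c) ring_scheme \<Rightarrow> ('r, 'm) module \<Rightarrow> bool" where
  "pm_module R M \<longleftrightarrow> (\<forall>P. prime_in R M P \<longrightarrow> (\<exists>!N. N \<in> Max_submodules R M \<and> P \<subseteq> N))"

definition primitive_submodules :: "('r, 'c) ring_scheme \<Rightarrow> ('r, 'm) module \<Rightarrow> 'm set set" where
  "primitive_submodules R M = {P. submodule P R M \<and> P \<noteq> carrier M \<and>
     (\<exists>S :: ('r, 'm) test_module. simple_module R S \<and> in_sigma R M S \<and> P = Ann R M S)}"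

definition semiprimitive :: "('r, 'c) ring_scheme \<Rightarrow> ('r, 'm) module \<Rightarrow> 'm set \<Rightarrow> bool" where
  "semiprimitive R M N \<longleftrightarrow> (\<exists>F. F \<noteq> {} \<and> F \<subseteq> primitive_submodules R M \<and> N = \<Inter>F)"


section \<open>The frame \<open>SPm(M)\<close> and its points\<close>

definition SPm :: "('r, 'c) ring_scheme \<Rightarrow> ('r, 'm) module \<Rightarrow> 'm set gorder" where
  "SPm R M = \<lparr>carrier = insert (carrier M) {N. semiprimitive R M N}, eq = (=), le = (\<subseteq>)\<rparr>"

definition pt :: "('a, 'd) gorder_scheme \<Rightarrow> 'a set" where
  "pt A = {p \<in> carrier A. p \<noteq> \<top>\<^bsub>A\<^esub> \<and>
     (\<forall>a\<in>carrier A. \<forall>b\<in>carrier A. a \<sqinter>\<^bsub>A\<^esub> b \<sqsubseteq>\<^bsub>A\<^esub> p \<longrightarrow> a \<sqsubseteq>\<^bsub>A\<^esub> p \<or> b \<sqsubseteq>\<^bsub>A\<^esub> p)}"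

lemma SPm_subset: "N \<in> carrier (SPm R M) \<Longrightarrow> N \<subseteq> carrier M"
  by (fastforce simp: SPm_def semiprimitive_def primitive_submodules_def Ann_def submodule_def
      dest: subgroup.subset)

lemma SPm_Int:
  assumes "N \<in> carrier (SPm R M)" "L \<in> carrier (SPm R M)"
  shows "N \<inter> L \<in> carrier (SPm R M)"
proof -
  have "semiprimitive R M (N \<inter> L)" if "semiprimitive R M N" "semiprimitive R M L"
  proof -
    from that obtain F F' where "F \<noteq> {}" "F \<subseteq> primitive_submodules R M" "N = \<Inter>F"
      "F' \<noteq> {}" "F' \<subseteq> primitive_submodules R M" "L = \<Inter>F'"
      unfolding semiprimitive_def by blast
    then show ?thesis unfolding semiprimitive_def by (intro exI[of _ "F \<union> F'"]) auto
  qed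
  moreover have "N \<subseteq> carrier M" "L \<subseteq> carrier M" using assms SPm_subset by blast+
  ultimately show ?thesis
    using assms by (auto simp: SPm_def Int_absorb1 Int_absorb2)
qed

lemma SPm_meet:
  assumes "N \<in> carrier (SPm R M)" "L \<in> carrier (SPm R M)"
  shows "N \<sqinter>\<^bsub>SPm R M\<^esub> L = N \<inter> L"
proof -
  have le: "(x \<sqsubseteq>\<^bsub>SPm R M\<^esub> y) = (x \<subseteq> y)" for x y by (simp add: SPm_def)
  have "Lower (SPm R M) {N, L} = {x \<in> carrier (SPm R M). x \<subseteq> N \<inter> L}"
    using assms by (auto simp: Lower_def le)
  then have "greatest (SPm R M) x (Lower (SPm R M) {N, L}) \<longleftrightarrow>
      x \<in> {x \<in> carrier (SPm R M). x \<subseteq> N \<inter> L} \<and> (\<forall>y\<in>carrier (SPm R M). y \<subseteq> N \<inter> L \<longrightarrow> y \<subseteq> x)" for x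
    by (auto simp: greatest_def le)
  then have "greatest (SPm R M) x (Lower (SPm R M) {N, L}) \<longleftrightarrow> x = N \<inter> L" for x
    using SPm_Int[OF assms] by (metis (mono_tags, lifting) mem_Collect_eq order_refl subset_antisym)
  then show ?thesis
    by (simp only: Lattice.meet_def Lattice.inf_def some_eq_trivial)
qed

lemma SPm_top: "\<top>\<^bsub>SPm R M\<^esub> = carrier M"
proof -
  have "greatest (SPm R M) x (carrier (SPm R M)) \<longleftrightarrow> x = carrier M" for x
    using SPm_subset[of _ R M] unfolding greatest_def
    by (auto simp: SPm_def)
  then show ?thesis unfolding Order.top_def by simp
qed


section \<open>Independence of the choice of types\<close>

lemma HomI:
  assumes "\<And>x. x \<in> carrier M \<Longrightarrow> f x \<in> carrier N"
    and "\<And>x y. x \<in> carrier M \<Longrightarrow> y \<in> carrier M \<Longrightarrow> f (x \<oplus>\<^bsub>M\<^esub> y) = f x \<oplus>\<^bsub>N\<^esub> f y"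
    and "\<And>r x. r \<in> carrier R \<Longrightarrow> x \<in> carrier M \<Longrightarrow> f (r \<odot>\<^bsub>M\<^esub> x) = r \<odot>\<^bsub>N\<^esub> f x"
  shows "f \<in> Hom R M N"
  using assms unfolding Hom_def by auto

lemma HomD:
  assumes "f \<in> Hom R M N"
  shows "x \<in> carrier M \<Longrightarrow> f x \<in> carrier N"
    and "x \<in> carrier M \<Longrightarrow> y \<in> carrier M \<Longrightarrow> f (x \<oplus>\<^bsub>M\<^esub> y) = f x \<oplus>\<^bsub>N\<^esub> f y"
    and "r \<in> carrier R \<Longrightarrow> x \<in> carrier M \<Longrightarrow> f (r \<odot>\<^bsub>M\<^esub> x) = r \<odot>\<^bsub>N\<^esub> f x"
  using assms unfolding Hom_def by auto

lemma Hom_comp: "f \<in> Hom R M N \<Longrightarrow> g \<in> Hom R N K \<Longrightarrow> (\<lambda>x. g (f x)) \<in> Hom R M K"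
  by (rule HomI) (simp_all add: HomD)

lemma (in left_module) smult_zeros:
  "x \<in> carrier M \<Longrightarrow> \<zero>\<^bsub>R\<^esub> \<odot> x = \<zero>"
  "r \<in> carrier R \<Longrightarrow> r \<odot> \<zero> = \<zero>"
proof -
  show "\<zero>\<^bsub>R\<^esub> \<odot> x = \<zero>" if "x \<in> carrier M"
    using smult_l_distr[of "\<zero>\<^bsub>R\<^esub>" "\<zero>\<^bsub>R\<^esub>" x] that
    by (metis R.l_zero R.zero_closed M.add.r_cancel_one' smult_closed)
  show "r \<odot> \<zero> = \<zero>" if "r \<in> carrier R"
    using smult_r_distr[of r \<zero> \<zero>] that
    by (metis M.l_zero M.zero_closed M.add.r_cancel_one' smult_closed)
qed

lemma Hom_zero:
  assumes "left_module R M" "left_module R N" "f \<in> Hom R M N"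
  shows "f \<zero>\<^bsub>M\<^esub> = \<zero>\<^bsub>N\<^esub>"
proof -
  interpret M: left_module R M by fact
  interpret N: left_module R N by fact
  have "f (\<zero>\<^bsub>R\<^esub> \<odot>\<^bsub>M\<^esub> \<zero>\<^bsub>M\<^esub>) = \<zero>\<^bsub>R\<^esub> \<odot>\<^bsub>N\<^esub> f \<zero>\<^bsub>M\<^esub>"
    using HomD(3)[OF assms(3)] by simp
  then show ?thesis using HomD(1)[OF assms(3)] by (simp add: M.smult_zeros N.smult_zeros)
qed

lemma left_moduleI:
  assumes R: "ring R" and 0: "\<zero>\<^bsub>M\<^esub> \<in> carrier M"
    and cl: "\<And>x y. x \<in> carrier M \<Longrightarrow> y \<in> carrier M \<Longrightarrow> x \<oplus>\<^bsub>M\<^esub> y \<in> carrier M"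
      "\<And>a x. a \<in> carrier R \<Longrightarrow> x \<in> carrier M \<Longrightarrow> a \<odot>\<^bsub>M\<^esub> x \<in> carrier M"
    and add: "\<And>x y z. x \<in> carrier M \<Longrightarrow> y \<in> carrier M \<Longrightarrow> z \<in> carrier M \<Longrightarrow>
        (x \<oplus>\<^bsub>M\<^esub> y) \<oplus>\<^bsub>M\<^esub> z = x \<oplus>\<^bsub>M\<^esub> (y \<oplus>\<^bsub>M\<^esub> z)"
      "\<And>x y. x \<in> carrier M \<Longrightarrow> y \<in> carrier M \<Longrightarrow> x \<oplus>\<^bsub>M\<^esub> y = y \<oplus>\<^bsub>M\<^esub> x"
      "\<And>x. x \<in> carrier M \<Longrightarrow> \<zero>\<^bsub>M\<^esub> \<oplus>\<^bsub>M\<^esub> x = x"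
    and sm: "\<And>x. x \<in> carrier M \<Longrightarrow> \<zero>\<^bsub>R\<^esub> \<odot>\<^bsub>M\<^esub> x = \<zero>\<^bsub>M\<^esub>"
      "\<And>a b x. a \<in> carrier R \<Longrightarrow> b \<in> carrier R \<Longrightarrow> x \<in> carrier M \<Longrightarrow>
        (a \<oplus>\<^bsub>R\<^esub> b) \<odot>\<^bsub>M\<^esub> x = a \<odot>\<^bsub>M\<^esub> x \<oplus>\<^bsub>M\<^esub> b \<odot>\<^bsub>M\<^esub> x"
      "\<And>a x y. a \<in> carrier R \<Longrightarrow> x \<in> carrier M \<Longrightarrow> y \<in> carrier M \<Longrightarrow>
        a \<odot>\<^bsub>M\<^esub> (x \<oplus>\<^bsub>M\<^esub> y) = a \<odot>\<^bsub>M\<^esub> x \<oplus>\<^bsub>M\<^esub> a \<odot>\<^bsub>M\<^esub> y"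
      "\<And>a b x. a \<in> carrier R \<Longrightarrow> b \<in> carrier R \<Longrightarrow> x \<in> carrier M \<Longrightarrow>
        (a \<otimes>\<^bsub>R\<^esub> b) \<odot>\<^bsub>M\<^esub> x = a \<odot>\<^bsub>M\<^esub> (b \<odot>\<^bsub>M\<^esub> x)"
      "\<And>x. x \<in> carrier M \<Longrightarrow> \<one>\<^bsub>R\<^esub> \<odot>\<^bsub>M\<^esub> x = x"
  shows "left_module R M"
proof -
  interpret R: ring R by fact
  have "\<exists>y\<in>carrier M. y \<oplus>\<^bsub>M\<^esub> x = \<zero>\<^bsub>M\<^esub>" if x: "x \<in> carrier M" for x
  proof
    let ?y = "(\<ominus>\<^bsub>R\<^esub> \<one>\<^bsub>R\<^esub>) \<odot>\<^bsub>M\<^esub> x"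
    show "?y \<in> carrier M" using x cl by simp
    have "?y \<oplus>\<^bsub>M\<^esub> x = (\<ominus>\<^bsub>R\<^esub> \<one>\<^bsub>R\<^esub> \<oplus>\<^bsub>R\<^esub> \<one>\<^bsub>R\<^esub>) \<odot>\<^bsub>M\<^esub> x"
      using sm(2)[of "\<ominus>\<^bsub>R\<^esub> \<one>\<^bsub>R\<^esub>" "\<one>\<^bsub>R\<^esub>" x] sm(5) x by simp
    then show "?y \<oplus>\<^bsub>M\<^esub> x = \<zero>\<^bsub>M\<^esub>" using sm(1) x by (simp add: R.l_neg)
  qed
  then have "abelian_group M" using 0 cl add by (intro abelian_groupI) auto
  then show ?thesis using R cl sm
    by (intro left_module.intro left_module_axioms.intro) auto
qed

lemma left_module_restrict:
  assumes "left_module R M" "H \<subseteq> carrier M" "\<zero>\<^bsub>M\<^esub> \<in> H"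
    "\<And>x y. x \<in> H \<Longrightarrow> y \<in> H \<Longrightarrow> x \<oplus>\<^bsub>M\<^esub> y \<in> H"
    "\<And>a x. a \<in> carrier R \<Longrightarrow> x \<in> H \<Longrightarrow> a \<odot>\<^bsub>M\<^esub> x \<in> H"
  shows "left_module R (M\<lparr>carrier := H\<rparr>)"
proof -
  interpret left_module R M by fact
  have H: "x \<in> carrier M" if "x \<in> H" for x using that assms by blast
  show ?thesis
    by (rule left_moduleI)
      (use assms H in \<open>auto simp: R.ring_axioms M.a_ac smult_zeros smult_l_distr
        smult_r_distr smult_assoc1\<close>)
qed

lemma left_module_image:
  assumes "left_module R M" "left_module R N" "f \<in> Hom R M N"
  shows "left_module R (N\<lparr>carrier := f ` carrier M\<rparr>)"
proof (rule left_module_restrict[OF assms(2)])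
  interpret M: left_module R M by fact
  show "f ` carrier M \<subseteq> carrier N" using HomD(1)[OF assms(3)] by blast
  show "\<zero>\<^bsub>N\<^esub> \<in> f ` carrier M" using Hom_zero[OF assms] M.M.zero_closed by (metis imageI)
  show "x \<oplus>\<^bsub>N\<^esub> y \<in> f ` carrier M" if "x \<in> f ` carrier M" "y \<in> f ` carrier M" for x y
    using that by (auto simp: HomD(2)[OF assms(3), symmetric])
  show "a \<odot>\<^bsub>N\<^esub> x \<in> f ` carrier M" if "a \<in> carrier R" "x \<in> f ` carrier M" for a x
    using that by (auto simp: HomD(3)[OF assms(3), symmetric])
qed

lemma left_module_direct_sum:
  fixes M (structure)
  assumes "left_module R M"
  shows "left_module R (direct_sum M I)"
proof -
  interpret left_module R M by fact
  have in_c: "f i \<in> carrier M" if "f \<in> carrier (direct_sum M I)" for f i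
    using that by (cases "i \<in> I") (auto simp: direct_sum_def)
  have fin: "finite {i. f i \<oplus> g i \<noteq> \<zero>}" if "finite {i. f i \<noteq> \<zero>}" "finite {i. g i \<noteq> \<zero>}" for f g
    by (rule finite_subset[of _ "{i. f i \<noteq> \<zero>} \<union> {i. g i \<noteq> \<zero>}"]) (use that in auto)
  have fin': "finite {i. i \<in> I \<and> r \<odot> f i \<noteq> \<zero>}" if "finite {i. f i \<noteq> \<zero>}" "r \<in> carrier R" for r f
    by (rule finite_subset[of _ "{i. f i \<noteq> \<zero>}"]) (use that in \<open>auto simp: smult_zeros\<close>)
  have out: "f i = \<zero>" if "f \<in> carrier (direct_sum M I)" "i \<notin> I" for f i
    using that by (auto simp: direct_sum_def)
  have ops: "\<zero>\<^bsub>direct_sum M I\<^esub> = (\<lambda>i. \<zero>)" "f \<oplus>\<^bsub>direct_sum M I\<^esub> g = (\<lambda>i. f i \<oplus> g i)"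
    "r \<odot>\<^bsub>direct_sum M I\<^esub> f = (\<lambda>i. if i \<in> I then r \<odot> f i else \<zero>)" for f g r
    by (auto simp: direct_sum_def)
  show ?thesis
  proof (rule left_moduleI)
    show "\<zero>\<^bsub>direct_sum M I\<^esub> \<in> carrier (direct_sum M I)" by (auto simp: direct_sum_def)
    show "f \<oplus>\<^bsub>direct_sum M I\<^esub> g \<in> carrier (direct_sum M I)"
      if "f \<in> carrier (direct_sum M I)" "g \<in> carrier (direct_sum M I)" for f g
      using that fin by (auto simp: direct_sum_def)
    show "r \<odot>\<^bsub>direct_sum M I\<^esub> f \<in> carrier (direct_sum M I)"
      if "r \<in> carrier R" "f \<in> carrier (direct_sum M I)" for r f
      using that fin'[of f r]
      by (auto simp: direct_sum_def elim!: rev_finite_subset[of "{i. i \<in> I \<and> _ i}"])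
  qed (auto simp: ops R.ring_axioms fun_eq_iff M.a_ac smult_zeros smult_l_distr
      smult_r_distr smult_assoc1 in_c out)
qed

definition transport :: "('r, 'm) module \<Rightarrow> ('m \<Rightarrow> 'n) \<Rightarrow> ('r, 'n) module" where
  "transport M e = (let d = inv_into (carrier M) e in
     \<lparr>carrier = e ` carrier M, monoid.mult = undefined, one = undefined, zero = e \<zero>\<^bsub>M\<^esub>,
      add = (\<lambda>x y. e (d x \<oplus>\<^bsub>M\<^esub> d y)), smult = (\<lambda>r x. e (r \<odot>\<^bsub>M\<^esub> d x))\<rparr>)"

lemma transport:
  assumes "left_module R M" "inj_on e (carrier M)"
  shows "left_module R (transport M e)"
    and "e \<in> Hom R M (transport M e)"
    and "inv_into (carrier M) e \<in> Hom R (transport M e) M"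
    and "carrier (transport M e) = e ` carrier M"
proof -
  interpret left_module R M by fact
  show "left_module R (transport M e)"
    by (rule left_moduleI)
      (use assms(2) in \<open>auto simp: transport_def Let_def R.ring_axioms M.a_ac smult_zeros
        smult_l_distr smult_r_distr smult_assoc1\<close>)
  show "e \<in> Hom R M (transport M e)"
    by (rule HomI) (use assms(2) in \<open>auto simp: transport_def Let_def\<close>)
  show "inv_into (carrier M) e \<in> Hom R (transport M e) M"
    by (rule HomI) (use assms(2) in \<open>auto simp: transport_def Let_def\<close>)
  show "carrier (transport M e) = e ` carrier M"
    by (simp add: transport_def Let_def)
qed

theorem in_sigmaI:
  fixes R :: "('r, 'c) ring_scheme" and M :: "('r, 'm) module" and X :: "('r, 'x) module"
    and I :: "'i set" and G :: "('r, 'g) module"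
  assumes M: "left_module R M" and X: "left_module R X"
    and G: "generated_by R M I G" and j: "j \<in> Hom R X G" "inj_on j (carrier X)"
  shows "in_sigma R M X"
proof -
  interpret M: left_module R M by fact
  let ?D = "direct_sum M I"
  obtain p where p: "p \<in> Hom R ?D G" "p ` carrier ?D = carrier G" and Gm: "left_module R G"
    using G unfolding generated_by_def surjective_on_def by blast
  have "\<exists>s\<in>carrier ?D. p s = j x" if "x \<in> carrier X" for x
    using p(2) HomD(1)[OF j(1) that] by (metis imageE)
  then obtain s where s: "\<And>x. x \<in> carrier X \<Longrightarrow> s x \<in> carrier ?D \<and> p (s x) = j x" by metis
  define J where "J = (\<Union>x\<in>carrier X. {i. s x i \<noteq> \<zero>\<^bsub>M\<^esub>})"
  have fin: "finite {i. s x i \<noteq> \<zero>\<^bsub>M\<^esub>}" if "x \<in> carrier X" for x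
    using s[OF that] by (auto simp: direct_sum_def)
  have JI: "J \<subseteq> I"
    using s by (auto simp: direct_sum_def J_def)
  have "\<exists>x\<in>carrier X. s x i \<noteq> \<zero>\<^bsub>M\<^esub>" if "i \<in> J" for i using that by (auto simp: J_def)
  then obtain w where w: "\<And>i. i \<in> J \<Longrightarrow> w i \<in> carrier X \<and> s (w i) i \<noteq> \<zero>\<^bsub>M\<^esub>" by metis
  define c where "c i = (w i, to_nat_on {k. s (w i) k \<noteq> \<zero>\<^bsub>M\<^esub>} i)" for i
  have c: "inj_on c J"
  proof (rule inj_onI)
    fix i k assume ik: "i \<in> J" "k \<in> J" "c i = c k"
    then have "w i = w k" by (simp add: c_def)
    moreover have "inj_on (to_nat_on {l. s (w i) l \<noteq> \<zero>\<^bsub>M\<^esub>}) {l. s (w i) l \<noteq> \<zero>\<^bsub>M\<^esub>}"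
      using fin w ik by (intro inj_on_to_nat_on countable_finite) blast
    ultimately show "i = k" using ik w[of i] w[of k] by (auto simp: c_def dest: inj_onD)
  qed
  define I' where "I' = c ` J"
  let ?D' = "direct_sum M I'"
  define \<phi> where "\<phi> f = (\<lambda>i. if i \<in> J then f (c i) else \<zero>\<^bsub>M\<^esub>)" for f :: "'x \<times> nat \<Rightarrow> 'm"
  have \<phi>: "\<phi> \<in> Hom R ?D' ?D"
  proof (rule HomI)
    fix f assume f: "f \<in> carrier ?D'"
    then have "finite (c ` {i \<in> J. f (c i) \<noteq> \<zero>\<^bsub>M\<^esub>})"
      by (auto simp: direct_sum_def elim!: rev_finite_subset)
    then have "finite {i \<in> J. f (c i) \<noteq> \<zero>\<^bsub>M\<^esub>}"
      using c by (subst (asm) finite_image_iff) (auto intro: inj_on_subset)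
    then have "finite {i. \<phi> f i \<noteq> \<zero>\<^bsub>M\<^esub>}" by (auto simp: \<phi>_def elim!: rev_finite_subset)
    moreover have "\<phi> f i \<in> carrier M" for i
      using f by (auto simp: direct_sum_def \<phi>_def I'_def)
    moreover have "\<phi> f i = \<zero>\<^bsub>M\<^esub>" if "i \<notin> I" for i using that JI by (auto simp: \<phi>_def)
    ultimately show "\<phi> f \<in> carrier ?D" by (auto simp: direct_sum_def)
  qed (use JI in \<open>auto simp: direct_sum_def \<phi>_def I'_def fun_eq_iff M.smult_zeros\<close>)
  define q where "q f = p (\<phi> f)" for f
  have q: "q \<in> Hom R ?D' G" unfolding q_def by (rule Hom_comp[OF \<phi> p(1)])
  define G' where "G' = G\<lparr>carrier := q ` carrier ?D'\<rparr>"
  have G': "left_module R G'"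
    unfolding G'_def by (rule left_module_image[OF left_module_direct_sum[OF M] Gm q])
  define e where "e y = {f \<in> carrier ?D'. q f = y}" for y
  have e: "inj_on e (carrier G')" by (auto simp: inj_on_def G'_def e_def)
  define H where "H = transport G' e"
  note H = transport[OF G' e, folded H_def]
  have qG': "q \<in> Hom R ?D' G'" using q unfolding Hom_def G'_def by auto
  have "(\<lambda>f. e (q f)) \<in> Hom R ?D' H" by (rule Hom_comp[OF qG' H(2)])
  moreover have "surjective_on ?D' H (\<lambda>f. e (q f))" by (auto simp: surjective_on_def H(4) G'_def)
  ultimately have "generated_by R M I' H" using H(1) unfolding generated_by_def by blast
  moreover have "j x \<in> carrier G'" if x: "x \<in> carrier X" for x
  proof -
    define f where "f k = (if k \<in> I' then s x (inv_into J c k) else \<zero>\<^bsub>M\<^esub>)" for k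
    have sx: "s x i = \<zero>\<^bsub>M\<^esub>" if "i \<notin> J" for i using that x by (auto simp: J_def)
    have "\<phi> f = s x" using c sx by (auto simp: fun_eq_iff \<phi>_def f_def I'_def)
    moreover have "f \<in> carrier ?D'"
    proof -
      have "{k. f k \<noteq> \<zero>\<^bsub>M\<^esub>} \<subseteq> c ` {i. s x i \<noteq> \<zero>\<^bsub>M\<^esub>}"
        using c by (auto simp: f_def I'_def split: if_splits)
      then have "finite {k. f k \<noteq> \<zero>\<^bsub>M\<^esub>}" using fin[OF x] finite_surj by blast
      moreover have "s x i \<in> carrier M" for i
        using s[OF x] by (cases "i \<in> I") (auto simp: direct_sum_def)
      ultimately show ?thesis by (auto simp: direct_sum_def f_def)
    qed
    ultimately have "q f = j x" "f \<in> carrier ?D'" using s[OF x] by (auto simp: q_def)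
    then show ?thesis by (simp add: G'_def) (metis imageI)
  qed
  then have jG': "j \<in> Hom R X G'" using j(1) unfolding Hom_def G'_def by auto
  then have "(\<lambda>x. e (j x)) \<in> Hom R X H" using H(2) by (rule Hom_comp)
  moreover have "inj_on (\<lambda>x. e (j x)) (carrier X)"
    using j(2) e HomD(1)[OF jG'] by (auto simp: inj_on_def)
  ultimately show ?thesis unfolding in_sigma_def using X by blast
qed

lemma in_sigma_mono:
  fixes M :: "('r, 'm) module" and X :: "('r, 'x) module"
  assumes "left_module R M" "in_sigma R M X" "left_module R Y" "i \<in> Hom R Y X" "inj_on i (carrier Y)"
  shows "in_sigma R M Y"
proof -
  from assms(2) obtain I :: "('x \<times> nat) set" and G :: "('r, ('x \<times> nat \<Rightarrow> 'm) set) module" and j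
    where G: "generated_by R M I G" and j: "j \<in> Hom R X G" "inj_on j (carrier X)"
    unfolding in_sigma_def by blast
  show ?thesis
  proof (rule in_sigmaI[OF assms(1,3) G])
    show "(\<lambda>x. j (i x)) \<in> Hom R Y G" by (rule Hom_comp[OF assms(4) j(1)])
    show "inj_on (\<lambda>x. j (i x)) (carrier Y)"
      using assms(5) j(2) HomD(1)[OF assms(4)] by (auto simp: inj_on_def)
  qed
qed

text \<open>Every submodule generated by an \<open>M\<close>-indexed family fits on the type of \<open>test_module\<close>.\<close>

lemma small_submodule:
  fixes R :: "('r, 'c) ring_scheme" and M :: "('r, 'm) module" and X :: "('r, 'x) module"
    and A :: "'m set"
  assumes X: "left_module R X" and t: "\<And>m. m \<in> A \<Longrightarrow> t m \<in> carrier X"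
  obtains H where "t ` A \<subseteq> H" "H \<subseteq> carrier X" "left_module R (X\<lparr>carrier := H\<rparr>)"
    "\<exists>e :: 'x \<Rightarrow> ('r \<times> 'm) list. inj_on e H"
proof -
  interpret X: left_module R X by fact
  define ev where "ev l = foldr (\<lambda>(r, m) y. r \<odot>\<^bsub>X\<^esub> t m \<oplus>\<^bsub>X\<^esub> y) l \<zero>\<^bsub>X\<^esub>" for l :: "('r \<times> 'm) list"
  have ev: "ev [] = \<zero>\<^bsub>X\<^esub>" "ev ((r, m) # l) = r \<odot>\<^bsub>X\<^esub> t m \<oplus>\<^bsub>X\<^esub> ev l" for r m l
    by (auto simp: ev_def)
  let ?L = "lists (carrier R \<times> A)"
  define H where "H = ev ` ?L"
  have evc: "ev l \<in> carrier X" if "l \<in> ?L" for l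
    using that by (induction l) (auto simp: ev t)
  have app: "ev (l @ k) = ev l \<oplus>\<^bsub>X\<^esub> ev k" if "l \<in> ?L" "k \<in> ?L" for l k
    using that(1)
  proof induction
    case (Cons a l)
    then show ?case
      using evc[OF Cons(2)] evc[OF that(2)] by (cases a) (auto simp: ev t X.M.a_assoc)
  qed (use evc[OF that(2)] in \<open>simp add: ev\<close>)
  have sm: "ev (map (\<lambda>(s, m). (r \<otimes>\<^bsub>R\<^esub> s, m)) l) = r \<odot>\<^bsub>X\<^esub> ev l"
    if "r \<in> carrier R" "l \<in> ?L" for r l
    using that(2)
  proof induction
    case (Cons a l)
    then show ?case using evc[OF Cons(2)] that(1)
      by (cases a) (auto simp: ev t X.smult_r_distr X.smult_assoc1)
  qed (use that(1) in \<open>simp add: ev X.smult_zeros\<close>)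
  show ?thesis
  proof (rule that[of H])
    show "t ` A \<subseteq> H"
    proof safe
      fix m assume m: "m \<in> A"
      then have "ev [(\<one>\<^bsub>R\<^esub>, m)] = t m" by (simp add: ev t)
      moreover have "[(\<one>\<^bsub>R\<^esub>, m)] \<in> ?L" using m by simp
      ultimately show "t m \<in> H" unfolding H_def by (metis imageI)
    qed
    show sub: "H \<subseteq> carrier X" using evc by (auto simp: H_def)
    show "left_module R (X\<lparr>carrier := H\<rparr>)"
    proof (rule left_module_restrict[OF X sub])
      show "\<zero>\<^bsub>X\<^esub> \<in> H" unfolding H_def using ev(1) by (metis imageI lists.Nil)
      show "x \<oplus>\<^bsub>X\<^esub> y \<in> H" if xy: "x \<in> H" "y \<in> H" for x y
      proof -
        from xy obtain l k where lk: "l \<in> ?L" "k \<in> ?L" "x = ev l" "y = ev k"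
          unfolding H_def by blast
        then have "l @ k \<in> ?L" "ev (l @ k) = x \<oplus>\<^bsub>X\<^esub> y" using app by auto
        then show ?thesis unfolding H_def by (metis imageI)
      qed
      show "r \<odot>\<^bsub>X\<^esub> x \<in> H" if rx: "r \<in> carrier R" "x \<in> H" for r x
      proof -
        from rx obtain l where l: "l \<in> ?L" "x = ev l" unfolding H_def by blast
        then have "map (\<lambda>(s, m). (r \<otimes>\<^bsub>R\<^esub> s, m)) l \<in> ?L" using rx(1) by (fastforce)
        then show ?thesis using sm[OF rx(1) l(1)] l(2) unfolding H_def by (metis imageI)
      qed
    qed
    have "inj_on (inv_into ?L ev) H" unfolding H_def by (rule inj_on_inv_into) simp
    then show "\<exists>e :: 'x \<Rightarrow> ('r \<times> 'm) list. inj_on e H" by blast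
  qed
qed

theorem projective_in_sigmaD:
  fixes R :: "('r, 'c) ring_scheme" and M :: "('r, 'm) module"
    and X :: "('r, 'x) module" and Y :: "('r, 'y) module"
  assumes M: "left_module R M" and proj: "projective_in_sigma R M"
    and X: "in_sigma R M X" and Y: "in_sigma R M Y"
    and g: "g \<in> Hom R X Y" "surjective_on X Y g" and f: "f \<in> Hom R M Y"
  shows "\<exists>h\<in>Hom R M X. \<forall>x\<in>carrier M. g (h x) = f x"
proof -
  have Xm: "left_module R X" and Ym: "left_module R Y" using X Y by (auto simp: in_sigma_def)
  have "\<exists>x\<in>carrier X. g x = f m" if "m \<in> carrier M" for m
    using g(2) HomD(1)[OF f that] unfolding surjective_on_def by (metis imageE)
  then obtain t where t: "\<And>m. m \<in> carrier M \<Longrightarrow> t m \<in> carrier X \<and> g (t m) = f m" by metis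
  obtain H and e :: "'x \<Rightarrow> ('r \<times> 'm) list" where H: "t ` carrier M \<subseteq> H" "H \<subseteq> carrier X"
    "left_module R (X\<lparr>carrier := H\<rparr>)" and e: "inj_on e H"
    using small_submodule[OF Xm, of "carrier M" t] t by metis
  let ?X1 = "X\<lparr>carrier := H\<rparr>"
  define Y1 where "Y1 = Y\<lparr>carrier := g ` H\<rparr>"
  have g1: "g \<in> Hom R ?X1 Y" using g(1) H(2) by (auto simp: Hom_def subset_iff)
  then have Y1m: "left_module R Y1"
    using left_module_image[OF H(3) Ym g1] unfolding Y1_def by simp
  define d where "d y = e (inv_into H g y)" for y
  have d: "inj_on d (carrier Y1)"
  proof (rule inj_onI)
    fix y y' assume y: "y \<in> carrier Y1" "y' \<in> carrier Y1" "d y = d y'"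
    then have "inv_into H g y = inv_into H g y'"
      using e by (auto simp: d_def Y1_def inj_on_def inv_into_into)
    then show "y = y'" using y by (auto simp: Y1_def dest: inv_into_injective)
  qed
  define X2 where "X2 = transport ?X1 e"
  define Y2 where "Y2 = transport Y1 d"
  have e': "inj_on e (carrier ?X1)" using e by simp
  note X2 = transport[OF H(3) e', folded X2_def]
  note Y2 = transport[OF Y1m d, folded Y2_def]
  have incl: "(\<lambda>x. x) \<in> Hom R ?X1 X" using H(2) by (auto simp: Hom_def subset_iff)
  have "in_sigma R M ?X1" by (rule in_sigma_mono[OF M X H(3) incl]) simp
  then have X2s: "in_sigma R M X2"
    by (rule in_sigma_mono[OF M _ X2(1,3)]) (simp only: X2(4) inj_on_inv_into)
  have Y1sub: "carrier Y1 \<subseteq> carrier Y" using HomD(1)[OF g1] by (auto simp: Y1_def)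
  have "(\<lambda>x. x) \<in> Hom R Y1 Y" using Y1sub by (auto simp: Hom_def Y1_def)
  then have "in_sigma R M Y1" by (rule in_sigma_mono[OF M Y Y1m]) simp
  then have Y2s: "in_sigma R M Y2"
    by (rule in_sigma_mono[OF M _ Y2(1,3)]) (simp only: Y2(4) inj_on_inv_into)
  let ?e' = "inv_into (carrier ?X1) e"
  have g1': "g \<in> Hom R ?X1 Y1" using g1 by (auto simp: Hom_def Y1_def)
  have g2: "(\<lambda>x. d (g (?e' x))) \<in> Hom R X2 Y2"
    by (rule Hom_comp[OF Hom_comp[OF X2(3) g1'] Y2(2)])
  have "surjective_on X2 Y2 (\<lambda>x. d (g (?e' x)))"
    using e by (auto simp: surjective_on_def X2(4) Y2(4) Y1_def image_image)
  moreover have f1: "f \<in> Hom R M Y1"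
  proof -
    have "f m \<in> g ` H" if "m \<in> carrier M" for m
      using t[OF that] H(1) that by (metis image_eqI image_subset_iff)
    then show ?thesis using f by (auto simp: Hom_def Y1_def)
  qed
  then have "(\<lambda>x. d (f x)) \<in> Hom R M Y2" using Y2(2) by (rule Hom_comp)
  ultimately obtain h where h: "h \<in> Hom R M X2"
    "\<And>x. x \<in> carrier M \<Longrightarrow> d (g (?e' (h x))) = d (f x)"
    using proj X2s Y2s g2 unfolding projective_in_sigma_def by meson
  have h1: "(\<lambda>x. ?e' (h x)) \<in> Hom R M ?X1" by (rule Hom_comp[OF h(1) X2(3)])
  have "g (?e' (h x)) = f x" if x: "x \<in> carrier M" for x
    using inj_onD[OF d h(2)[OF x] HomD(1)[OF g1' HomD(1)[OF h1 x]] HomD(1)[OF f1 x]] .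
  moreover have "(\<lambda>x. ?e' (h x)) \<in> Hom R M X" using Hom_comp[OF h1 incl] .
  ultimately show ?thesis by (intro bexI[of _ "\<lambda>x. ?e' (h x)"] ballI)
qed

theorem primitive_submodulesI:
  fixes R :: "('r, 'c) ring_scheme" and M :: "('r, 'm) module" and S :: "('r, 's) module"
  assumes M: "left_module R M" and S: "simple_module R S" "in_sigma R M S"
    and P: "submodule (Ann R M S) R M" "Ann R M S \<noteq> carrier M"
  shows "Ann R M S \<in> primitive_submodules R M"
proof -
  have Sm: "left_module R S" using S by (auto simp: simple_module_def)
  interpret S: left_module R S by fact
  interpret M: left_module R M by fact
  obtain x where x: "x \<in> carrier S" "x \<noteq> \<zero>\<^bsub>S\<^esub>"
    using S(1) S.M.zero_closed by (auto simp: simple_module_def)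
  obtain H and e :: "'s \<Rightarrow> ('r \<times> 'm) list" where H: "(\<lambda>m. x) ` {undefined :: 'm} \<subseteq> H"
    "H \<subseteq> carrier S" "left_module R (S\<lparr>carrier := H\<rparr>)" "inj_on e H"
    using small_submodule[OF Sm, of "{undefined :: 'm}" "\<lambda>m. x"] x by metis
  interpret H: left_module R "S\<lparr>carrier := H\<rparr>" by fact
  have "group (add_monoid S)" using S.M.a_comm_group by (simp add: comm_group_def)
  then have "subgroup H (add_monoid S)"
    using H.M.a_comm_group H(2) group.group_incl_imp_subgroup[of "add_monoid S" H]
    by (simp add: comm_group_def)
  then have "submodule H R S"
    using H.smult_closed by (auto intro!: submodule.intro submodule_axioms.intro)
  then have HS: "H = carrier S" using S(1) H(1) x by (auto simp: simple_module_def)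
  then have e: "inj_on e (carrier S)" using H(4) by simp
  define T where "T = transport S e"
  note T = transport[OF Sm e, folded T_def]
  let ?d = "inv_into (carrier S) e"
  have d: "inj_on ?d (carrier T)" by (simp only: T(4) inj_on_inv_into)
  have Ts: "in_sigma R M T" by (rule in_sigma_mono[OF M S(2) T(1,3) d])
  have zT: "\<zero>\<^bsub>T\<^esub> = e \<zero>\<^bsub>S\<^esub>" by (simp add: T_def transport_def Let_def)
  have "simple_module R T" unfolding simple_module_def
  proof (intro conjI allI impI)
    show "left_module R T" by (rule T(1))
    show "carrier T \<noteq> {\<zero>\<^bsub>T\<^esub>}"
      using x e by (auto simp: T(4) zT dest: inj_onD)
    fix N assume N: "submodule N R T"
    interpret T: left_module R T by (rule T(1))
    interpret N: submodule N R T by (rule N)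
    have NT: "N \<subseteq> carrier T" using N.subset by simp
    have "left_module R (T\<lparr>carrier := N\<rparr>)"
      using N.one_closed N.m_closed by (intro left_module_restrict[OF T(1) NT]) auto
    moreover have "?d \<in> Hom R (T\<lparr>carrier := N\<rparr>) S" using T(3) NT by (auto simp: Hom_def subset_iff)
    ultimately interpret K: left_module R "S\<lparr>carrier := ?d ` N\<rparr>"
      using left_module_image[OF _ Sm, of "T\<lparr>carrier := N\<rparr>" ?d] by simp
    have sub: "?d ` N \<subseteq> carrier S" using NT HomD(1)[OF T(3)] by blast
    have "subgroup (?d ` N) (add_monoid S)"
      using K.M.a_comm_group sub \<open>group (add_monoid S)\<close>
        group.group_incl_imp_subgroup[of "add_monoid S" "?d ` N"]
      by (simp add: comm_group_def)
    then have "submodule (?d ` N) R S"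
      using K.smult_closed by (auto intro!: submodule.intro submodule_axioms.intro)
    then have "?d ` N = {\<zero>\<^bsub>S\<^esub>} \<or> ?d ` N = carrier S" using S(1) by (auto simp: simple_module_def)
    moreover have "e ` (?d ` N) = N"
      using NT by (force simp: image_image T(4) f_inv_into_f)
    ultimately show "N = {\<zero>\<^bsub>T\<^esub>} \<or> N = carrier T" by (auto simp: zT T(4))
  qed
  moreover have "Ann R M S = Ann R M T"
  proof -
    have "f m = \<zero>\<^bsub>S\<^esub>" if "f \<in> Hom R M S" "m \<in> Ann R M T" for f m
    proof -
      have "(\<lambda>x. e (f x)) \<in> Hom R M T" by (rule Hom_comp[OF that(1) T(2)])
      then have "e (f m) = e \<zero>\<^bsub>S\<^esub>" "m \<in> carrier M" using that(2) by (auto simp: Ann_def zT)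
      then show ?thesis using e HomD(1)[OF that(1)] by (auto dest: inj_onD)
    qed
    moreover have "f m = \<zero>\<^bsub>T\<^esub>" if "f \<in> Hom R M T" "m \<in> Ann R M S" for f m
    proof -
      have "(\<lambda>x. ?d (f x)) \<in> Hom R M S" by (rule Hom_comp[OF that(1) T(3)])
      then have "?d (f m) = \<zero>\<^bsub>S\<^esub>" "m \<in> carrier M" using that(2) by (auto simp: Ann_def)
      moreover have "f m \<in> e ` carrier S" using HomD(1)[OF that(1) \<open>m \<in> carrier M\<close>] T(4) by simp
      ultimately show ?thesis by (metis f_inv_into_f zT)
    qed
    moreover have z: "(\<lambda>x. \<zero>\<^bsub>S\<^esub>) \<in> Hom R M S" by (rule HomI) (auto simp: S.smult_zeros)
    then have "Ann R M S \<subseteq> carrier M" unfolding Ann_def by blast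
    moreover have "Ann R M T \<subseteq> carrier M"
      using Hom_comp[OF z T(2)] unfolding Ann_def by blast
    ultimately show ?thesis unfolding Ann_def by (intro equalityI subsetI INT_I CollectI conjI) blast+
  qed
  ultimately show ?thesis using Ts P unfolding primitive_submodules_def by auto
qed

end

theory Submission
  imports Defs "HOL-Algebra.AbelCoset"
begin

text \<open>
  If \<open>P = Ann\<^sub>M(S)\<close> with \<open>S\<close> simple and \<open>K\<close> is a fully invariant submodule not contained in \<open>P\<close>,
  then some \<open>g : M \<rightarrow> S\<close> maps \<open>K\<close> onto \<open>S\<close>. By projectivity every \<open>h : M \<rightarrow> S\<close> lifts along
  \<open>g\<close> to some \<open>M \<rightarrow> K\<close>, so \<open>L\<^sub>M K \<subseteq> P\<close> forces \<open>h(L) = 0\<close>. Hence primitive submodules are prime.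
  In a pm-module \<open>P\<close> therefore lies in only one maximal submodule. The kernels of the nonzero maps
  \<open>M \<rightarrow> S\<close> are maximal and contain \<open>P\<close>, so they all coincide and \<open>P\<close>, being their
  intersection, is maximal; applied to \<open>S = M/N\<close> this shows that a maximal \<open>N\<close> is primitive.
  Finally, a point of \<open>SPm(M)\<close> is an intersection of primitive, i.e. maximal, submodules, and it
  is prime because each of these is, so this intersection has a single member.
\<close>

section \<open>Submodules, kernels and factor modules\<close>

text \<open>Closure under negatives is automatic, since -x = (-1)x; this is built into
  \<open>left_moduleI\<close> and arrives here through \<open>left_module_restrict\<close>.\<close>

lemma submodule_iff:
  assumes "left_module R M"
  shows "submodule N R M \<longleftrightarrow> N \<subseteq> carrier M \<and> \<zero>\<^bsub>M\<^esub> \<in> N \<and>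
    (\<forall>x\<in>N. \<forall>y\<in>N. x \<oplus>\<^bsub>M\<^esub> y \<in> N) \<and> (\<forall>r\<in>carrier R. \<forall>x\<in>N. r \<odot>\<^bsub>M\<^esub> x \<in> N)"
    (is "_ \<longleftrightarrow> ?closed")
proof
  assume "submodule N R M"
  then interpret N: submodule N R M .
  show ?closed
    using N.subset N.one_closed N.m_closed N.smult_closed by auto
next
  assume N: ?closed
  interpret left_module R M by fact
  interpret N: left_module R "M\<lparr>carrier := N\<rparr>"
    using N by (intro left_module_restrict[OF assms]) auto
  have "subgroup N (add_monoid M)"
    using N N.M.a_comm_group
    by (intro M.add.group_incl_imp_subgroup) (auto simp: comm_group_def)
  then show "submodule N R M"
    using N by (auto intro!: submodule.intro submodule_axioms.intro)
qed

lemma left_module_submodule: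
  assumes "left_module R M" "submodule N R M"
  shows "left_module R (M\<lparr>carrier := N\<rparr>)"
  using assms by (intro left_module_restrict[OF assms(1)]) (auto simp: submodule_iff)

lemma submodule_carrier: "left_module R M \<Longrightarrow> submodule (carrier M) R M"
proof -
  assume M: "left_module R M"
  then interpret left_module R M .
  show ?thesis by (simp add: submodule_iff[OF M])
qed

lemma submodule_Inter:
  assumes "left_module R M" "F \<noteq> {}" "\<And>N. N \<in> F \<Longrightarrow> submodule N R M"
  shows "submodule (\<Inter>F) R M"
  using assms(2,3) unfolding submodule_iff[OF assms(1)] by blast

lemma submodule_image:
  assumes M: "left_module R M" and X: "left_module R X" and f: "f \<in> Hom R M X"
    and N: "submodule N R M"
  shows "submodule (f ` N) R X"
proof -
  have NM: "N \<subseteq> carrier M" using N by (simp add: submodule_iff[OF M])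
  then have 0: "\<zero>\<^bsub>X\<^esub> \<in> f ` N"
    using N Hom_zero[OF M X f] by (metis submodule_iff[OF M] imageI)
  have "f x \<oplus>\<^bsub>X\<^esub> f y \<in> f ` N" if "x \<in> N" "y \<in> N" for x y
    using that N NM HomD(2)[OF f, of x y, symmetric] by (auto simp: submodule_iff[OF M])
  moreover have "r \<odot>\<^bsub>X\<^esub> f x \<in> f ` N" if "r \<in> carrier R" "x \<in> N" for r x
    using that N NM HomD(3)[OF f, of r x, symmetric] by (auto simp: submodule_iff[OF M])
  ultimately show ?thesis
    using 0 NM HomD(1)[OF f] by (auto simp: submodule_iff[OF X])
qed

lemma submodule_vimage:
  assumes M: "left_module R M" and X: "left_module R X" and f: "f \<in> Hom R M X"
    and N: "submodule N R X"
  shows "submodule {x \<in> carrier M. f x \<in> N} R M"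
proof -
  interpret M: left_module R M by fact
  show ?thesis
    using N by (auto simp: submodule_iff[OF M] submodule_iff[OF X] HomD[OF f] Hom_zero[OF M X f])
qed

definition hom_ker :: "('r, 'm) module \<Rightarrow> ('r, 'n) module \<Rightarrow> ('m \<Rightarrow> 'n) \<Rightarrow> 'm set" where
  "hom_ker M X f = {x \<in> carrier M. f x = \<zero>\<^bsub>X\<^esub>}"

lemma submodule_zero: "left_module R M \<Longrightarrow> submodule {\<zero>\<^bsub>M\<^esub>} R M"
proof -
  assume M: "left_module R M"
  then interpret left_module R M .
  show ?thesis by (simp add: submodule_iff[OF M] smult_zeros)
qed

lemma submodule_hom_ker:
  assumes "left_module R M" "left_module R X" "f \<in> Hom R M X"
  shows "submodule (hom_ker M X f) R M"
  using submodule_vimage[OF assms submodule_zero[OF assms(2)]] by (simp add: hom_ker_def)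

lemma hom_minus:
  assumes M: "left_module R M" and X: "left_module R X" and f: "f \<in> Hom R M X"
    and "x \<in> carrier M" "y \<in> carrier M"
  shows "f (x \<ominus>\<^bsub>M\<^esub> y) = f x \<ominus>\<^bsub>X\<^esub> f y"
proof -
  interpret M: left_module R M by fact
  interpret X: left_module R X by fact
  have "f (x \<ominus>\<^bsub>M\<^esub> y) \<oplus>\<^bsub>X\<^esub> f y = f x"
    using assms(4,5) by (simp add: HomD(2)[OF f, symmetric] a_minus_def M.M.a_assoc M.M.l_neg)
  then show ?thesis
    using assms(4,5) HomD(1)[OF f]
    by (metis M.M.minus_closed X.M.minus_eq X.M.add.inv_solve_right)
qed

text \<open>The scalar multiple of a coset is a union over all its representatives, which avoids
  choosing one. Adding \<open>N\<close> back matters: for r = 0 the elementwise multiples alone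
  would give the set of zero instead of \<open>N\<close>.\<close>

definition factor_module :: "('r, 'm) module \<Rightarrow> 'm set \<Rightarrow> ('r, 'm set) module" where
  "factor_module M N = \<lparr>carrier = a_rcosets\<^bsub>M\<^esub> N, monoid.mult = undefined, one = undefined,
     zero = N, add = set_add M, smult = (\<lambda>r A. \<Union>x\<in>A. N +>\<^bsub>M\<^esub> (r \<odot>\<^bsub>M\<^esub> x))\<rparr>"

lemma factor_module:
  assumes M: "left_module R M" and N: "submodule N R M"
  shows "left_module R (factor_module M N)"
    and "(\<lambda>x. N +>\<^bsub>M\<^esub> x) \<in> Hom R M (factor_module M N)"
    and "surjective_on M (factor_module M N) (\<lambda>x. N +>\<^bsub>M\<^esub> x)"
    and "hom_ker M (factor_module M N) (\<lambda>x. N +>\<^bsub>M\<^esub> x) = N"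
proof -
  interpret left_module R M by fact
  interpret N: submodule N R M by fact
  have sg: "subgroup N (add_monoid M)" by (rule N.subgroup_axioms)
  interpret A: abelian_subgroup N M
    by (rule abelian_subgroupI2[OF M.a_comm_group sg])
  have NM: "N \<subseteq> carrier M" using N.subset by simp
  let ?q = "\<lambda>x. N +>\<^bsub>M\<^esub> x" and ?F = "factor_module M N"
  have carr: "carrier ?F = ?q ` carrier M"
    by (auto simp: factor_module_def A_RCOSETS_def')
  have zero: "\<zero>\<^bsub>?F\<^esub> = ?q \<zero>\<^bsub>M\<^esub>" using NM by (simp add: factor_module_def)
  have add: "?q x \<oplus>\<^bsub>?F\<^esub> ?q y = ?q (x \<oplus>\<^bsub>M\<^esub> y)" if "x \<in> carrier M" "y \<in> carrier M" for x y
    using A.a_rcos_sum[OF that] by (simp add: factor_module_def)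
  have smult: "r \<odot>\<^bsub>?F\<^esub> ?q x = ?q (r \<odot>\<^bsub>M\<^esub> x)" if r: "r \<in> carrier R" and x: "x \<in> carrier M" for r x
  proof -
    have "?q (r \<odot>\<^bsub>M\<^esub> y) = ?q (r \<odot>\<^bsub>M\<^esub> x)" if "y \<in> ?q x" for y
    proof -
      obtain n where n: "n \<in> N" "y = n \<oplus>\<^bsub>M\<^esub> x" using \<open>y \<in> ?q x\<close> by (auto simp: a_r_coset_def')
      then have "r \<odot>\<^bsub>M\<^esub> y = r \<odot>\<^bsub>M\<^esub> n \<oplus>\<^bsub>M\<^esub> r \<odot>\<^bsub>M\<^esub> x"
        using smult_r_distr r x NM by blast
      moreover have "r \<odot>\<^bsub>M\<^esub> n \<in> N" using n r by blast
      ultimately have "r \<odot>\<^bsub>M\<^esub> y \<in> ?q (r \<odot>\<^bsub>M\<^esub> x)" by (auto simp: a_r_coset_def')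
      then show ?thesis by (rule M.a_repr_independence[OF _ smult_closed[OF r x] sg, symmetric])
    qed
    \<comment> \<open>The coset is nonempty, so the union of equal cosets is that coset and not the
      empty set.\<close>
    moreover have "x \<in> ?q x" using A.a_rcos_self x by blast
    ultimately have "(\<Union>y\<in>?q x. ?q (r \<odot>\<^bsub>M\<^esub> y)) = ?q (r \<odot>\<^bsub>M\<^esub> x)"
      by blast
    then show ?thesis by (simp add: factor_module_def)
  qed
  show "left_module R ?F"
    by (rule left_moduleI)
      (auto simp: carr zero add smult R.ring_axioms M.a_ac smult_zeros smult_l_distr
        smult_r_distr smult_assoc1)
  show "?q \<in> Hom R M ?F" by (rule HomI) (auto simp: carr add smult)
  show "surjective_on M ?F ?q" by (simp add: surjective_on_def carr)
  have "?q x = N \<longleftrightarrow> x \<in> N" if "x \<in> carrier M" for x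
    using that M.a_coset_join1[OF _ that sg] M.a_coset_join2[OF that sg] by blast
  then show "hom_ker M ?F ?q = N"
    using NM by (auto simp: hom_ker_def factor_module_def)
qed

text \<open>An image of \<open>M\<close> is generated by a single copy of \<open>M\<close>, indexed
  by the one element of type \<open>unit\<close>, and it embeds in itself by the identity.\<close>

lemma in_sigma_surjective_image:
  assumes M: "left_module R M" and X: "left_module R X"
    and f: "f \<in> Hom R M X" "surjective_on M X f"
  shows "in_sigma R M X"
proof (rule in_sigmaI[OF M X])
  interpret M: left_module R M by fact
  let ?D = "direct_sum M {()}"
  have proj: "(\<lambda>u. u ()) ` carrier ?D = carrier M"
  proof safe
    fix x assume "x \<in> carrier M"
    then show "x \<in> (\<lambda>u. u ()) ` carrier ?D"
      by (intro image_eqI[of _ _ "\<lambda>_. x"]) (auto simp: direct_sum_def)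
  qed (auto simp: direct_sum_def)
  have "surjective_on ?D X (\<lambda>u. f (u ()))"
    using f(2) unfolding surjective_on_def proj[symmetric] image_image .
  moreover have "(\<lambda>u. u ()) \<in> Hom R ?D M"
    by (rule HomI) (auto simp: direct_sum_def)
  then have "(\<lambda>u. f (u ())) \<in> Hom R ?D X" using f(1) by (rule Hom_comp)
  ultimately show "generated_by R M {()} X" using X by (auto simp: generated_by_def)
  show "(\<lambda>x. x) \<in> Hom R X X" by (rule HomI) auto
qed simp

text \<open>This allows projectivity to lift maps along an epimorphism whose source is a submodule
  of \<open>M\<close>.\<close>

lemma in_sigma_submodule:
  assumes M: "left_module R M" and K: "submodule K R M"
  shows "in_sigma R M (M\<lparr>carrier := K\<rparr>)"
proof (rule in_sigma_mono[OF M _ left_module_submodule[OF M K]])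
  show "in_sigma R M M"
    by (rule in_sigma_surjective_image[OF M M, of "\<lambda>x. x"]) (auto simp: Hom_def surjective_on_def)
  show "(\<lambda>x. x) \<in> Hom R (M\<lparr>carrier := K\<rparr>) M"
    using K by (auto simp: Hom_def submodule_iff[OF M])
qed simp

section \<open>Simple modules and maximal submodules\<close>

text \<open>If \<open>L\<close> contains the kernel, then f(L) is 0 or \<open>S\<close> by
  simplicity. In the first case \<open>L\<close> is the kernel; in the second every x differs from
  some element of \<open>L\<close> by an element of the kernel, so \<open>L\<close> is all of
  \<open>M\<close>.\<close>

lemma hom_ker_maximal:
  assumes M: "left_module R M" and S: "simple_module R S"
    and f: "f \<in> Hom R M S" "hom_ker M S f \<noteq> carrier M"
  shows "hom_ker M S f \<in> Max_submodules R M"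
proof -
  have Sm: "left_module R S" using S by (simp add: simple_module_def)
  interpret M: left_module R M by fact
  interpret S: left_module R S by fact
  have "L = hom_ker M S f \<or> L = carrier M"
    if L: "submodule L R M" and ker: "hom_ker M S f \<subseteq> L" for L
  proof -
    have LM: "L \<subseteq> carrier M" using L by (simp add: submodule_iff[OF M])
    consider "f ` L = {\<zero>\<^bsub>S\<^esub>}" | "f ` L = carrier S"
      using S submodule_image[OF M Sm f(1) L] by (auto simp: simple_module_def)
    then show ?thesis
    proof cases
      case 1
      then have "L \<subseteq> hom_ker M S f" using LM by (auto simp: hom_ker_def)
      then show ?thesis using ker by blast
    next
      case 2
      have "x \<in> L" if x: "x \<in> carrier M" for x
      proof -
        obtain l where l: "l \<in> L" "f l = f x" using 2 HomD(1)[OF f(1) x] by (metis imageE)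
        have lM: "l \<in> carrier M" using l LM by blast
        have "f (x \<ominus>\<^bsub>M\<^esub> l) = \<zero>\<^bsub>S\<^esub>"
          using hom_minus[OF M Sm f(1) x lM] l HomD(1)[OF f(1) x] by (simp add: S.M.minus_eq S.M.r_neg)
        then have "x \<ominus>\<^bsub>M\<^esub> l \<in> L" using ker x lM by (auto simp: hom_ker_def)
        then have "(x \<ominus>\<^bsub>M\<^esub> l) \<oplus>\<^bsub>M\<^esub> l \<in> L" using l L by (simp add: submodule_iff[OF M])
        then show ?thesis using x lM by (simp add: a_minus_def M.M.a_assoc M.M.l_neg)
      qed
      then show ?thesis using LM by blast
    qed
  qed
  then show ?thesis
    using f(2) submodule_hom_ker[OF M Sm f(1)] by (simp add: Max_submodules_def)
qed

text \<open>The preimage of a submodule of \<open>X\<close> lies between the maximal kernel and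
  \<open>M\<close>, hence is one of the two; surjectivity recovers the submodule as the image of its
  preimage.\<close>

lemma simple_moduleI_hom_ker:
  assumes M: "left_module R M" and X: "left_module R X"
    and f: "f \<in> Hom R M X" "surjective_on M X f" and max: "hom_ker M X f \<in> Max_submodules R M"
  shows "simple_module R X"
  unfolding simple_module_def
proof (intro conjI allI impI)
  have fM: "f ` carrier M = carrier X" using f(2) by (simp add: surjective_on_def)
  show "left_module R X" by (rule X)
  show "carrier X \<noteq> {\<zero>\<^bsub>X\<^esub>}"
  proof
    assume "carrier X = {\<zero>\<^bsub>X\<^esub>}"
    then have "hom_ker M X f = carrier M" using HomD(1)[OF f(1)] by (auto simp: hom_ker_def)
    then show False using max by (simp add: Max_submodules_def)
  qed
  fix L assume L: "submodule L R X"
  let ?V = "{x \<in> carrier M. f x \<in> L}"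
  have L': "L \<subseteq> carrier X" "\<zero>\<^bsub>X\<^esub> \<in> L" using L by (auto simp: submodule_iff[OF X])
  then have fV: "f ` ?V = L" using fM by auto
  have "hom_ker M X f \<subseteq> ?V" using L' by (auto simp: hom_ker_def)
  then have "?V = hom_ker M X f \<or> ?V = carrier M"
    using max submodule_vimage[OF M X f(1) L] by (simp add: Max_submodules_def)
  then show "L = {\<zero>\<^bsub>X\<^esub>} \<or> L = carrier X"
  proof
    assume "?V = hom_ker M X f"
    then have "L \<subseteq> {\<zero>\<^bsub>X\<^esub>}" using fV by (auto simp: hom_ker_def)
    then show ?thesis using L' by blast
  qed (use fV fM in auto)
qed

section \<open>Primitive submodules\<close>

lemma Ann_eq_Inter_hom_ker: "Ann R M K = (\<Inter>f\<in>Hom R M K. hom_ker M K f)"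
  by (simp add: Ann_def hom_ker_def)

lemma submodule_Ann:
  assumes M: "left_module R M" and K: "left_module R K"
  shows "submodule (Ann R M K) R M"
proof -
  interpret K: left_module R K by fact
  \<comment> \<open>The zero map keeps the intersection of kernels from ranging over an empty
    family.\<close>
  have "(\<lambda>x. \<zero>\<^bsub>K\<^esub>) \<in> Hom R M K" by (rule HomI) (auto simp: K.smult_zeros)
  then show ?thesis
    unfolding Ann_eq_Inter_hom_ker
    by (intro submodule_Inter[OF M]) (auto intro: submodule_hom_ker[OF M K])
qed

text \<open>Composing a map \<open>M\<close> to \<open>K\<close> with an endomorphism of
  \<open>M\<close> gives another map \<open>M\<close> to \<open>K\<close>, which therefore kills the
  annihilator.\<close>

lemma fully_invariant_Ann:
  assumes M: "left_module R M" and K: "left_module R K"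
  shows "fully_invariant R M (Ann R M K)"
  unfolding fully_invariant_def
proof (intro conjI ballI submodule_Ann[OF M K])
  fix f assume f: "f \<in> Hom R M M"
  have sub: "Ann R M K \<subseteq> carrier M" using submodule_Ann[OF M K] by (simp add: submodule_iff[OF M])
  show "f ` Ann R M K \<subseteq> Ann R M K"
  proof safe
    fix x assume x: "x \<in> Ann R M K"
    have "g (f x) = \<zero>\<^bsub>K\<^esub>" if "g \<in> Hom R M K" for g
      using x Hom_comp[OF f that] by (auto simp: Ann_def)
    then show "f x \<in> Ann R M K" using x sub HomD(1)[OF f] by (auto simp: Ann_def)
  qed
qed

lemma primitive_submoduleE:
  fixes M :: "('r, 'm) module"
  assumes "P \<in> primitive_submodules R M"
  obtains S :: "('r, 'm) test_module" where "simple_module R S" "left_module R S" "in_sigma R M S"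
    "P = Ann R M S" "P \<noteq> carrier M"
  using assms by (auto simp: primitive_submodules_def simple_module_def)

lemma primitive_fully_invariant:
  assumes M: "left_module R M" and P: "P \<in> primitive_submodules R M"
  shows "fully_invariant R M P"
  using primitive_submoduleE[OF P] fully_invariant_Ann[OF M] by metis

lemma primitive_prime:
  fixes M :: "('r, 'm) module"
  assumes M: "left_module R M" and proj: "projective_in_sigma R M"
    and P: "P \<in> primitive_submodules R M"
  shows "prime_in R M P"
  unfolding prime_in_def
proof (intro conjI allI impI)
  obtain S :: "('r, 'm) test_module" where S: "simple_module R S" "left_module R S"
    "in_sigma R M S" "P = Ann R M S" "P \<noteq> carrier M"
    using primitive_submoduleE[OF P] .
  show "fully_invariant R M P" by (rule primitive_fully_invariant[OF M P])
  show "P \<noteq> carrier M" by (rule S)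
  fix L K assume L: "fully_invariant R M L" and K: "fully_invariant R M K"
    and prod: "mprod R M L (M\<lparr>carrier := K\<rparr>) \<subseteq> P"
  have Ks: "submodule K R M" and Ls: "submodule L R M"
    using K L by (auto simp: fully_invariant_def)
  then have KM: "K \<subseteq> carrier M" and LM: "L \<subseteq> carrier M" by (auto simp: submodule_iff[OF M])
  show "L \<subseteq> P \<or> K \<subseteq> P"
  proof (cases "K \<subseteq> P")
    case False
    then obtain g k where g: "g \<in> Hom R M S" and k: "k \<in> K" "g k \<noteq> \<zero>\<^bsub>S\<^esub>"
      using KM by (auto simp: S(4) Ann_def)
    have "submodule (g ` K) R S" by (rule submodule_image[OF M S(2) g Ks])
    moreover have "g ` K \<noteq> {\<zero>\<^bsub>S\<^esub>}" using k by blast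
    ultimately have "g ` K = carrier S" using S(1) by (auto simp: simple_module_def)
    then have surj: "surjective_on (M\<lparr>carrier := K\<rparr>) S g" by (simp add: surjective_on_def)
    have gK: "g \<in> Hom R (M\<lparr>carrier := K\<rparr>) S" using g KM by (auto simp: Hom_def subset_iff)
    have "h x = \<zero>\<^bsub>S\<^esub>" if h: "h \<in> Hom R M S" and x: "x \<in> L" for h x
    proof -
      obtain h' where h': "h' \<in> Hom R M (M\<lparr>carrier := K\<rparr>)" "\<And>x. x \<in> carrier M \<Longrightarrow> g (h' x) = h x"
        using projective_in_sigmaD[OF M proj in_sigma_submodule[OF M Ks] S(3) gK surj h] by blast
      \<comment> \<open>The lift has values in \<open>K\<close>, so it carries \<open>L\<close> into
        the product, hence into \<open>P\<close>; and \<open>g\<close> vanishes on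
        \<open>P\<close>.\<close>
      have "h' x \<in> mprod R M L (M\<lparr>carrier := K\<rparr>)" using h'(1) x by (auto simp: mprod_def)
      then have "g (h' x) = \<zero>\<^bsub>S\<^esub>" using prod g by (auto simp: S(4) Ann_def)
      then show ?thesis using h'(2) x LM by auto
    qed
    then show ?thesis using LM by (auto simp: S(4) Ann_def)
  qed simp
qed

lemma primitive_eq_maximal:
  fixes M :: "('r, 'm) module"
  assumes M: "left_module R M" and proj: "projective_in_sigma R M" and pm: "pm_module R M"
  shows "primitive_submodules R M = Max_submodules R M"
proof (intro equalityI subsetI)
  fix P assume P: "P \<in> primitive_submodules R M"
  then obtain S :: "('r, 'm) test_module" where S: "simple_module R S" "left_module R S"
    "P = Ann R M S" "P \<noteq> carrier M"
    by (rule primitive_submoduleE)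
  obtain N where N: "N \<in> Max_submodules R M" "P \<subseteq> N"
    and uniq: "\<And>N'. N' \<in> Max_submodules R M \<Longrightarrow> P \<subseteq> N' \<Longrightarrow> N' = N"
    using pm primitive_prime[OF M proj P] unfolding pm_module_def by metis
  have "N \<subseteq> hom_ker M S f" if f: "f \<in> Hom R M S" for f
  \<comment> \<open>The zero homomorphism is treated apart, as its kernel is not maximal; all other
    kernels are maximal over \<open>P\<close> and so equal \<open>N\<close>.\<close>
  proof (cases "hom_ker M S f = carrier M")
    case True
    then show ?thesis using N by (auto simp: Max_submodules_def submodule_iff[OF M])
  next
    case False
    moreover have "P \<subseteq> hom_ker M S f" using f by (auto simp: S(3) Ann_eq_Inter_hom_ker)
    ultimately show ?thesis using uniq hom_ker_maximal[OF M S(1) f] by blast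
  qed
  then have "N \<subseteq> P" unfolding S(3) Ann_eq_Inter_hom_ker by blast
  then show "P \<in> Max_submodules R M" using N by auto
next
  fix N assume max: "N \<in> Max_submodules R M"
  then have N: "submodule N R M" "N \<noteq> carrier M" by (auto simp: Max_submodules_def)
  let ?F = "factor_module M N"
  note F = factor_module[OF M N(1)]
  have S: "simple_module R ?F" using simple_moduleI_hom_ker[OF M F(1-3)] F(4) max by simp
  let ?P = "Ann R M ?F"
  \<comment> \<open>The canonical projection is one of the maps defining the annihilator, and its
    kernel is \<open>N\<close>.\<close>
  have PN: "?P \<subseteq> N" using F(2,4) unfolding Ann_eq_Inter_hom_ker by blast
  moreover have "N \<subseteq> carrier M" using N(1) by (simp add: submodule_iff[OF M])
  ultimately have "?P \<noteq> carrier M" using N(2) by blast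
  then have prim: "?P \<in> primitive_submodules R M"
    by (rule primitive_submodulesI[OF M S in_sigma_surjective_image[OF M F(1-3)]
          submodule_Ann[OF M F(1)]])
  have "N \<subseteq> hom_ker M ?F f" if f: "f \<in> Hom R M ?F" for f
  proof (cases "hom_ker M ?F f = carrier M")
    case True
    then show ?thesis using N by (simp add: submodule_iff[OF M])
  next
    case False
    \<comment> \<open>Both \<open>N\<close> and this kernel are maximal submodules above the prime
      \<open>?P\<close>, so the pm condition identifies them.\<close>
    moreover have "?P \<subseteq> hom_ker M ?F f" using f unfolding Ann_eq_Inter_hom_ker by blast
    ultimately show ?thesis
      using hom_ker_maximal[OF M S f] max PN pm primitive_prime[OF M proj prim]
      unfolding pm_module_def by (metis order_refl)
  qed
  then have "N = ?P" using PN unfolding Ann_eq_Inter_hom_ker by blast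
  then show "N \<in> primitive_submodules R M" using prim by simp
qed

section \<open>Points of the frame of semiprimitive submodules\<close>

lemma pt_SPm_iff:
  "p \<in> pt (SPm R M) \<longleftrightarrow> p \<in> carrier (SPm R M) \<and> p \<noteq> carrier M \<and>
    (\<forall>a\<in>carrier (SPm R M). \<forall>b\<in>carrier (SPm R M). a \<inter> b \<subseteq> p \<longrightarrow> a \<subseteq> p \<or> b \<subseteq> p)"
proof -
  have "x \<sqsubseteq>\<^bsub>SPm R M\<^esub> y \<longleftrightarrow> x \<subseteq> y" for x y by (simp add: SPm_def)
  then show ?thesis unfolding pt_def by (auto simp: SPm_top SPm_meet)
qed

text \<open>Makes elements of the frame admissible in \<open>prime_in\<close>, which tests only
  fully invariant submodules.\<close>

lemma SPm_fully_invariant: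
  assumes M: "left_module R M" and a: "a \<in> carrier (SPm R M)"
  shows "fully_invariant R M a"
proof -
  consider "a = carrier M" | F where "F \<noteq> {}" "F \<subseteq> primitive_submodules R M" "a = \<Inter>F"
    using a by (auto simp: SPm_def semiprimitive_def)
  then show ?thesis
  proof cases
    case 1
    then show ?thesis
      using submodule_carrier[OF M] HomD(1) by (fastforce simp: fully_invariant_def)
  next
    case 2
    then have "\<And>P. P \<in> F \<Longrightarrow> fully_invariant R M P" using primitive_fully_invariant[OF M] by blast
    then show ?thesis
      using submodule_Inter[OF M 2(1)] 2(3) by (fastforce simp: fully_invariant_def)
  qed
qed

text \<open>A map from \<open>M\<close> to \<open>K\<close>, followed by the inclusion, is an
  endomorphism of \<open>M\<close> and so preserves \<open>L\<close>.\<close>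

lemma mprod_subset_Int:
  assumes M: "left_module R M" and L: "fully_invariant R M L" and K: "fully_invariant R M K"
  shows "mprod R M L (M\<lparr>carrier := K\<rparr>) \<subseteq> L \<inter> K"
proof -
  have LK: "submodule L R M" "submodule K R M" using L K by (auto simp: fully_invariant_def)
  then have KM: "K \<subseteq> carrier M" "L \<subseteq> carrier M" by (auto simp: submodule_iff[OF M])
  have "submodule (L \<inter> K) R (M\<lparr>carrier := K\<rparr>)"
    unfolding submodule_iff[OF left_module_submodule[OF M LK(2)]]
    using LK by (auto simp: submodule_iff[OF M])
  moreover have "f ` L \<subseteq> L \<inter> K" if f: "f \<in> Hom R M (M\<lparr>carrier := K\<rparr>)" for f
  proof -
    have "f \<in> Hom R M M" using f KM by (auto simp: Hom_def)
    then have "f ` L \<subseteq> L" using L by (simp add: fully_invariant_def)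
    moreover have "f ` L \<subseteq> K" using HomD(1)[OF f] KM by auto
    ultimately show ?thesis by blast
  qed
  ultimately show ?thesis unfolding mprod_def by blast
qed

text \<open>The product of a and b lies in their intersection, so an intersection below p puts the
  product below p and primeness applies.\<close>

lemma prime_in_pt_SPm:
  assumes M: "left_module R M" and p: "prime_in R M p" "p \<in> carrier (SPm R M)"
  shows "p \<in> pt (SPm R M)"
  unfolding pt_SPm_iff
proof (intro conjI ballI impI)
  show "p \<noteq> carrier M" using p by (simp add: prime_in_def)
  fix a b assume ab: "a \<in> carrier (SPm R M)" "b \<in> carrier (SPm R M)" "a \<inter> b \<subseteq> p"
  then have "fully_invariant R M a" "fully_invariant R M b"
    using SPm_fully_invariant[OF M] by auto
  then show "a \<subseteq> p \<or> b \<subseteq> p"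
    using p(1) mprod_subset_Int[OF M] ab(3) unfolding prime_in_def by (meson subset_trans)
qed (rule p(2))

text \<open>Intersecting with \<open>carrier M\<close> only matters when no primitive submodule contains \<open>L\<close>,
  since \<open>\<Inter>{} = UNIV\<close>.\<close>

definition SPm_closure :: "('r, 'c) ring_scheme \<Rightarrow> ('r, 'm) module \<Rightarrow> 'm set \<Rightarrow> 'm set" where
  "SPm_closure R M L = carrier M \<inter> \<Inter>{Q \<in> primitive_submodules R M. L \<subseteq> Q}"

lemma SPm_closure_in_SPm: "SPm_closure R M L \<in> carrier (SPm R M)"
\<comment> \<open>\<open>semiprimitive\<close> demands a nonempty family; if no primitive submodule
  contains \<open>L\<close>, the closure is the top element of the frame.\<close>
proof (cases "{Q \<in> primitive_submodules R M. L \<subseteq> Q} = {}")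
  case True
  then show ?thesis unfolding SPm_closure_def True by (simp add: SPm_def)
next
  case False
  have "Q \<subseteq> carrier M" if "Q \<in> primitive_submodules R M" for Q
    using that
    by (intro SPm_subset[of Q R M]) (auto simp: SPm_def semiprimitive_def intro!: exI[of _ "{Q}"])
  then have "SPm_closure R M L = \<Inter>{Q \<in> primitive_submodules R M. L \<subseteq> Q}"
    using False unfolding SPm_closure_def by blast
  then have "semiprimitive R M (SPm_closure R M L)"
    using False unfolding semiprimitive_def
    by (intro exI[of _ "{Q \<in> primitive_submodules R M. L \<subseteq> Q}"]) blast
  then show ?thesis by (simp add: SPm_def)
qed

lemma subset_SPm_closure: "L \<subseteq> carrier M \<Longrightarrow> L \<subseteq> SPm_closure R M L"
  by (auto simp: SPm_closure_def)

lemma SPm_closure_subset: "Q \<in> primitive_submodules R M \<Longrightarrow> L \<subseteq> Q \<Longrightarrow> SPm_closure R M L \<subseteq> Q"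
  by (auto simp: SPm_closure_def)

text \<open>\<open>L\<close> and \<open>K\<close> need not belong to the frame, so they are replaced
  by their closures. Each primitive \<open>Q\<close> in a family with intersection p is prime and
  contains the product, hence contains \<open>L\<close> or \<open>K\<close> and with it the closure.
  Thus the closures meet below p, and the point property applies to them.\<close>

lemma pt_SPm_prime:
  assumes M: "left_module R M" and proj: "projective_in_sigma R M" and p: "p \<in> pt (SPm R M)"
  shows "prime_in R M p"
  unfolding prime_in_def
proof (intro conjI allI impI)
  have pc: "p \<in> carrier (SPm R M)" and pM: "p \<noteq> carrier M"
    and pt: "\<And>a b. a \<in> carrier (SPm R M) \<Longrightarrow> b \<in> carrier (SPm R M) \<Longrightarrow> a \<inter> b \<subseteq> p \<Longrightarrow>
      a \<subseteq> p \<or> b \<subseteq> p"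
    using p by (auto simp: pt_SPm_iff)
  show "fully_invariant R M p" by (rule SPm_fully_invariant[OF M pc])
  show "p \<noteq> carrier M" by (rule pM)
  obtain F where F: "F \<subseteq> primitive_submodules R M" "p = \<Inter>F"
    using pc pM by (auto simp: SPm_def semiprimitive_def)
  fix L K assume L: "fully_invariant R M L" and K: "fully_invariant R M K"
    and prod: "mprod R M L (M\<lparr>carrier := K\<rparr>) \<subseteq> p"
  have "SPm_closure R M L \<inter> SPm_closure R M K \<subseteq> Q" if "Q \<in> F" for Q
  proof -
    have Q: "Q \<in> primitive_submodules R M" using that F by blast
    moreover have "mprod R M L (M\<lparr>carrier := K\<rparr>) \<subseteq> Q" using prod that F by blast
    ultimately have "L \<subseteq> Q \<or> K \<subseteq> Q"
      using primitive_prime[OF M proj Q] L K by (auto simp: prime_in_def)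
    then show ?thesis using SPm_closure_subset[OF Q] by blast
  qed
  then have "SPm_closure R M L \<inter> SPm_closure R M K \<subseteq> p" using F by blast
  then have "SPm_closure R M L \<subseteq> p \<or> SPm_closure R M K \<subseteq> p"
    by (intro pt SPm_closure_in_SPm)
  moreover have "L \<subseteq> carrier M" "K \<subseteq> carrier M"
    using L K by (auto simp: fully_invariant_def submodule_iff[OF M])
  ultimately show "L \<subseteq> p \<or> K \<subseteq> p" using subset_SPm_closure by (metis subset_trans)
qed

theorem proposition3p20:
  fixes R :: "('r, 'c) ring_scheme" and M :: "('r, 'm) module"
  assumes "ring R" and "left_module R M"
    and "projective_in_sigma R M"
    and "pm_module R M"
  shows "pt (SPm R M) = primitive_submodules R M \<and>
         primitive_submodules R M = Max_submodules R M"
proof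
  note M = assms(2) and proj = assms(3) and pm = assms(4)
  show max: "primitive_submodules R M = Max_submodules R M"
    by (rule primitive_eq_maximal[OF M proj pm])
  show "pt (SPm R M) = primitive_submodules R M"
  proof (intro equalityI subsetI)
    fix p assume p: "p \<in> pt (SPm R M)"
    then have "p \<in> carrier (SPm R M)" "p \<noteq> carrier M" by (auto simp: pt_SPm_iff)
    then obtain F where F: "F \<noteq> {}" "F \<subseteq> primitive_submodules R M" "p = \<Inter>F"
      by (auto simp: SPm_def semiprimitive_def)
    obtain N where "\<And>N'. N' \<in> Max_submodules R M \<Longrightarrow> p \<subseteq> N' \<Longrightarrow> N' = N"
      using pm pt_SPm_prime[OF M proj p] unfolding pm_module_def by metis
    \<comment> \<open>Every member of \<open>F\<close> is maximal and contains p, so it equals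
      \<open>N\<close>; \<open>F\<close> itself is nonempty.\<close>
    then have "F = {N}" using F max by blast
    then show "p \<in> primitive_submodules R M" using F by simp
  next
    fix P assume P: "P \<in> primitive_submodules R M"
    then have "P \<in> carrier (SPm R M)"
      by (auto simp: SPm_def semiprimitive_def intro!: exI[of _ "{P}"])
    then show "P \<in> pt (SPm R M)" by (rule prime_in_pt_SPm[OF M primitive_prime[OF M proj P]])
  qed
qed

end
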